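(* Let $\mu^{\rm b},\mu^{\rm a}\in\mathcal{P}_1$ with $\mu^{\rm b}\preceq_{\rm cx}\mu^{\rm a}$ and let $\mu^{\rm m}=\frac{\mu^{\rm b}+\mu^{\rm a}}{2}$. Suppose that $h=\psi^{\rm a}-\psi^{\rm b}$ for some Lipschitz convex functions $\psi^{\rm a},\psi^{\rm b}:\mathbb{R}_+\to\mathbb{R}$. Then $$0\le P(h)-\mu^{\rm m}(h)\le C\,d(\mu^{\rm b},\mu^{\rm a}),\qquad C=\mathrm{Lip}(\psi^{\rm a})+\mathrm{Lip}(\psi^{\rm b}),$$ where $P(h)=\sup\{\mu(h):\mu\in\mathcal{P}_1,\ \mu^{\rm b}\preceq_{\rm cx}\mu\preceq_{\rm cx}\mu^{\rm a}\}$.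
   Context: $\mathbb{R}_+=[0,\infty)$; $\mathcal{P}_1$ is the set of probability measures on $\mathbb{R}_+$ with finite first moment; $\mu(f)=\int f\,d\mu$. $\mu\preceq_{\rm cx}\nu$ (convex order) means $\mu(\psi)\le\nu(\psi)$ for all continuous convex $\psi:\mathbb{R}_+\to\mathbb{R}$ of linear growth. $\mathrm{Lip}(\psi)$ is the Lipschitz constant of $\psi$. The bid–ask distance is $d(\mu,\nu)=\frac12(\vec d(\mu,\nu)+\vec d(\nu,\mu))$ with $\vec d(\mu,\nu)=\sup\{\mu(\psi)-\nu(\psi):\psi:\mathbb{R}_+\to\mathbb{R}\text{ convex, }\mathrm{Lip}(\psi)\le1\}$. *)

theory Defs
  imports "HOL-Probability.Probability"
begin

text \<open>
  Functions on \<open>[0, \<infinity>)\<close> are represented by total functions \<^typ>\<open>real \<Rightarrow> real\<close> of which only the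
  restriction to \<open>{0..}\<close> matters: measures in \<open>P1\<close> have underlying space \<open>{0..}\<close>, and continuity,
  convexity, growth and Lipschitz conditions are imposed on \<open>{0..}\<close> only.  Suprema are taken in
  \<^typ>\<open>ereal\<close>, so that no boundedness is presupposed.
\<close>

definition P1 :: "real measure set" where
  "P1 = {\<mu>. prob_space \<mu> \<and> sets \<mu> = sets (restrict_space borel {0..}) \<and> integrable \<mu> (\<lambda>x. x)}"

definition linear_growth :: "(real \<Rightarrow> real) \<Rightarrow> bool" where
  "linear_growth \<psi> \<longleftrightarrow> (\<exists>c. \<forall>x\<ge>0. \<bar>\<psi> x\<bar> \<le> c * (1 + x))"

definition convex_order :: "real measure \<Rightarrow> real measure \<Rightarrow> bool" (infix "\<preceq>cx" 50) where
  "\<mu> \<preceq>cx \<nu> \<longleftrightarrow> (\<forall>\<psi>. continuous_on {0..} \<psi> \<and> convex_on {0..} \<psi> \<and> linear_growth \<psi> \<longrightarrow>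
     integral\<^sup>L \<mu> \<psi> \<le> integral\<^sup>L \<nu> \<psi>)"

text \<open>The optimal Lipschitz constant; it is \<open>\<infinity>\<close> if \<open>\<psi>\<close> is not Lipschitz on \<open>{0..}\<close>.\<close>

definition Lip :: "(real \<Rightarrow> real) \<Rightarrow> ereal" where
  "Lip \<psi> = (INF L\<in>{L. L-lipschitz_on {0..} \<psi>}. ereal L)"

definition directed_dist :: "real measure \<Rightarrow> real measure \<Rightarrow> ereal" where
  "directed_dist \<mu> \<nu> =
     (SUP \<psi>\<in>{\<psi>. convex_on {0..} \<psi> \<and> Lip \<psi> \<le> 1}. ereal (integral\<^sup>L \<mu> \<psi> - integral\<^sup>L \<nu> \<psi>))"

definition bid_ask_dist :: "real measure \<Rightarrow> real measure \<Rightarrow> ereal" where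
  "bid_ask_dist \<mu> \<nu> = (directed_dist \<mu> \<nu> + directed_dist \<nu> \<mu>) / 2"

definition mid_measure :: "real measure \<Rightarrow> real measure \<Rightarrow> real measure" where
  "mid_measure \<mu> \<nu> = measure_of (space \<mu>) (sets \<mu>) (\<lambda>A. (emeasure \<mu> A + emeasure \<nu> A) / 2)"

text \<open>The set function in \<^const>\<open>mid_measure\<close> is a measure, so \<^const>\<open>measure_of\<close> keeps it.\<close>

lemma sets_mid_measure [simp]: "sets (mid_measure \<mu> \<nu>) = sets \<mu>"
  by (simp add: mid_measure_def)

lemma emeasure_mid_measure:
  assumes "sets \<mu> = sets \<nu>" "A \<in> sets \<mu>"
  shows "emeasure (mid_measure \<mu> \<nu>) A = (emeasure \<mu> A + emeasure \<nu> A) / 2"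
  unfolding mid_measure_def
proof (rule emeasure_measure_of_sigma[OF sets.sigma_algebra_axioms _ _ assms(2)])
  show "positive (sets \<mu>) (\<lambda>A. (emeasure \<mu> A + emeasure \<nu> A) / 2)"
    by (simp add: positive_def)
  show "countably_additive (sets \<mu>) (\<lambda>A. (emeasure \<mu> A + emeasure \<nu> A) / 2)"
  proof (rule countably_additiveI)
    fix F :: "nat \<Rightarrow> real set"
    assume F: "range F \<subseteq> sets \<mu>" "disjoint_family F"
    have "(\<Sum>i. (emeasure \<mu> (F i) + emeasure \<nu> (F i)) / 2) =
        ((\<Sum>i. emeasure \<mu> (F i)) + (\<Sum>i. emeasure \<nu> (F i))) / 2"
      by (simp add: divide_ennreal_def suminf_add)
    also have "\<dots> = (emeasure \<mu> (\<Union>i. F i) + emeasure \<nu> (\<Union>i. F i)) / 2"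
      using F assms(1) by (simp add: suminf_emeasure)
    finally show "(\<Sum>i. (emeasure \<mu> (F i) + emeasure \<nu> (F i)) / 2) =
        (emeasure \<mu> (\<Union>i. F i) + emeasure \<nu> (\<Union>i. F i)) / 2" .
  qed
qed

definition upper_price :: "real measure \<Rightarrow> real measure \<Rightarrow> (real \<Rightarrow> real) \<Rightarrow> ereal" where
  "upper_price \<mu>b \<mu>a h = (SUP \<mu>\<in>{\<mu>\<in>P1. \<mu>b \<preceq>cx \<mu> \<and> \<mu> \<preceq>cx \<mu>a}. ereal (integral\<^sup>L \<mu> h))"

end

theory Submission
  imports Defs
begin

text \<open>
  Every admissible \<open>\<mu>\<close> satisfies \<open>\<mu>(\<psi>\<^sup>a) - \<mu>(\<psi>\<^sup>b) \<le> \<mu>\<^sup>a(\<psi>\<^sup>a) - \<mu>\<^sup>b(\<psi>\<^sup>b)\<close>, and subtracting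
  \<open>\<mu>\<^sup>m(\<psi>\<^sup>a - \<psi>\<^sup>b)\<close> from the right-hand side leaves half of
  \<open>(\<mu>\<^sup>a - \<mu>\<^sup>b)(\<psi>\<^sup>a) + (\<mu>\<^sup>a - \<mu>\<^sup>b)(\<psi>\<^sup>b)\<close>.  Each of the two terms is at most the Lipschitz
  constant times the directed distance from \<open>\<mu>\<^sup>a\<close> to \<open>\<mu>\<^sup>b\<close>, which is at most twice the bid-ask
  distance.  The lower bound holds because \<open>\<mu>\<^sup>m\<close> is itself admissible.
\<close>

section \<open>Integration against the midpoint measure\<close>

lemma space_P1: "\<mu> \<in> P1 \<Longrightarrow> space \<mu> = {0..}"
  using sets_eq_imp_space_eq[of \<mu> "restrict_space borel {0..}"]
  by (simp add: P1_def space_restrict_space)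

lemma sets_P1: "\<mu> \<in> P1 \<Longrightarrow> sets \<mu> = sets (restrict_space borel {0..})"
  by (simp add: P1_def)

lemma space_mid_measure [simp]: "space (mid_measure \<mu> \<nu>) = space \<mu>"
  by (rule sets_eq_imp_space_eq) simp

text \<open>Both sides are additive and homogeneous in \<open>f\<close> and pass to suprema of
  increasing sequences, so by induction on measurable functions only indicators remain, where the
  formula for \<open>emeasure\<close> applies.\<close>

lemma nn_integral_mid_measure:
  assumes s: "sets \<mu> = sets \<nu>" and f: "f \<in> borel_measurable \<mu>"
  shows "(\<integral>\<^sup>+x. f x \<partial>mid_measure \<mu> \<nu>) = ((\<integral>\<^sup>+x. f x \<partial>\<mu>) + (\<integral>\<^sup>+x. f x \<partial>\<nu>)) / 2"
proof -
  have sp: "space \<nu> = space \<mu>" using sets_eq_imp_space_eq[OF s] by simp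
  have meas: "g \<in> borel_measurable \<nu>" "g \<in> borel_measurable (mid_measure \<mu> \<nu>)"
    if "g \<in> borel_measurable \<mu>" for g :: "real \<Rightarrow> ennreal"
    using that measurable_cong_sets[OF s refl] measurable_cong_sets[OF sets_mid_measure refl]
    by blast+
  show ?thesis
    using f
  proof (induction rule: borel_measurable_induct)
    case (cong f g)
    have "(\<integral>\<^sup>+x. f x \<partial>mid_measure \<mu> \<nu>) = (\<integral>\<^sup>+x. g x \<partial>mid_measure \<mu> \<nu>)"
      by (rule nn_integral_cong) (simp add: cong)
    moreover have "(\<integral>\<^sup>+x. f x \<partial>\<mu>) = (\<integral>\<^sup>+x. g x \<partial>\<mu>)" "(\<integral>\<^sup>+x. f x \<partial>\<nu>) = (\<integral>\<^sup>+x. g x \<partial>\<nu>)"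
      by (auto intro!: nn_integral_cong simp: cong sp)
    ultimately show ?case using cong by simp
  next
    case (set A)
    then show ?case using s by (simp add: emeasure_mid_measure)
  next
    case (mult u c)
    then show ?case
      by (simp add: meas nn_integral_cmult distrib_left ennreal_times_divide)
  next
    case (add u v)
    then show ?case
      by (simp add: meas nn_integral_add divide_ennreal_def algebra_simps)
  next
    case (seq U)
    have m: "U i \<in> borel_measurable \<mu>" "U i \<in> borel_measurable \<nu>"
      "U i \<in> borel_measurable (mid_measure \<mu> \<nu>)" for i
      using seq(1)[of i] by (simp_all add: meas)
    \<comment> \<open>Monotonicity in \<open>i\<close> is what lets the supremum of the sums split
      into the sum of the suprema.\<close>
    have inc: "incseq (\<lambda>i. \<integral>\<^sup>+x. U i x \<partial>M)" for M
      using seq(3) by (auto simp: incseq_def le_fun_def intro!: nn_integral_mono)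
    have "(\<integral>\<^sup>+x. Sup (range U) x \<partial>mid_measure \<mu> \<nu>) = (SUP i. \<integral>\<^sup>+x. U i x \<partial>mid_measure \<mu> \<nu>)"
      using nn_integral_monotone_convergence_SUP[OF seq(3) m(3)] by (simp add: image_comp)
    also have "\<dots> = (SUP i. ((\<integral>\<^sup>+x. U i x \<partial>\<mu>) + (\<integral>\<^sup>+x. U i x \<partial>\<nu>)) / 2)"
      using seq by simp
    also have "\<dots> = ((SUP i. \<integral>\<^sup>+x. U i x \<partial>\<mu>) + (SUP i. \<integral>\<^sup>+x. U i x \<partial>\<nu>)) / 2"
      by (simp only: divide_ennreal_def SUP_mult_right_ennreal[symmetric] ennreal_SUP_add[OF inc inc])
    also have "\<dots> = ((\<integral>\<^sup>+x. Sup (range U) x \<partial>\<mu>) + (\<integral>\<^sup>+x. Sup (range U) x \<partial>\<nu>)) / 2"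
      using nn_integral_monotone_convergence_SUP[OF seq(3) m(1)]
        nn_integral_monotone_convergence_SUP[OF seq(3) m(2)] by (simp add: image_comp)
    finally show ?case .
  qed
qed

text \<open>The preceding identity applies to the positive and negative parts of \<open>f\<close>
  separately. Integrability makes the four integrals over \<mu> and \<nu> finite, so they can be
  named by reals and subtracted.\<close>

lemma
  fixes f :: "real \<Rightarrow> real"
  assumes s: "sets \<mu> = sets \<nu>" and f: "integrable \<mu> f" "integrable \<nu> f"
  shows integrable_mid_measure: "integrable (mid_measure \<mu> \<nu>) f"
    and integral_mid_measure:
      "integral\<^sup>L (mid_measure \<mu> \<nu>) f = (integral\<^sup>L \<mu> f + integral\<^sup>L \<nu> f) / 2"
proof -
  have m: "f \<in> borel_measurable \<mu>" using f by simp
  have nn: "(\<integral>\<^sup>+x. ennreal (g x) \<partial>mid_measure \<mu> \<nu>) =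
      ((\<integral>\<^sup>+x. ennreal (g x) \<partial>\<mu>) + (\<integral>\<^sup>+x. ennreal (g x) \<partial>\<nu>)) / 2"
    if "g \<in> borel_measurable \<mu>" for g :: "real \<Rightarrow> real"
    using that by (intro nn_integral_mid_measure s) simp
  have fin: "\<exists>r\<ge>0. t = ennreal r" if "t \<noteq> \<infinity>" for t
    using that by (cases t) auto
  note ri = real_integrable_def[THEN iffD1]
  obtain p where p: "0 \<le> p" "(\<integral>\<^sup>+x. ennreal (f x) \<partial>\<mu>) = ennreal p"
    using fin ri[OF f(1)] by blast
  obtain q where q: "0 \<le> q" "(\<integral>\<^sup>+x. ennreal (f x) \<partial>\<nu>) = ennreal q"
    using fin ri[OF f(2)] by blast
  obtain p' where p': "0 \<le> p'" "(\<integral>\<^sup>+x. ennreal (- f x) \<partial>\<mu>) = ennreal p'"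
    using fin ri[OF f(1)] by blast
  obtain q' where q': "0 \<le> q'" "(\<integral>\<^sup>+x. ennreal (- f x) \<partial>\<nu>) = ennreal q'"
    using fin ri[OF f(2)] by blast
  have e: "(\<integral>\<^sup>+x. ennreal (f x) \<partial>mid_measure \<mu> \<nu>) = ennreal ((p + q) / 2)"
    "(\<integral>\<^sup>+x. ennreal (- f x) \<partial>mid_measure \<mu> \<nu>) = ennreal ((p' + q') / 2)"
    using m p q p' q'
    by (simp_all add: nn ennreal_plus[symmetric] divide_ennreal[symmetric] del: ennreal_plus)
  show i: "integrable (mid_measure \<mu> \<nu>) f"
    using m e by (simp add: real_integrable_def measurable_cong_sets[OF sets_mid_measure refl])
  show "integral\<^sup>L (mid_measure \<mu> \<nu>) f = (integral\<^sup>L \<mu> f + integral\<^sup>L \<nu> f) / 2"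
    using i f p q p' q' e by (simp add: real_lebesgue_integral_def field_simps)
qed

section \<open>Growth and integrability of test functions\<close>

lemma lipschitz_imp_linear_growth:
  assumes "L-lipschitz_on {0..} \<psi>"
  shows "linear_growth \<psi>"
  unfolding linear_growth_def
proof (intro exI allI impI)
  fix x :: real assume x: "x \<ge> 0"
  have L: "0 \<le> L" using assms by (rule lipschitz_on_nonneg)
  have "dist (\<psi> x) (\<psi> 0) \<le> L * dist x 0"
    using x by (intro lipschitz_onD[OF assms]) auto
  then have "\<bar>\<psi> x\<bar> \<le> \<bar>\<psi> 0\<bar> + L * x"
    using x by (simp add: dist_real_def)
  also have "\<dots> \<le> (\<bar>\<psi> 0\<bar> + L) * (1 + x)"
    using x L by (simp add: algebra_simps)
  finally show "\<bar>\<psi> x\<bar> \<le> (\<bar>\<psi> 0\<bar> + L) * (1 + x)" .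
qed

text \<open>The dominating function \<open>c * (1 + x)\<close> is integrable because total mass and
  first moment are finite.\<close>

lemma integrable_P1:
  assumes \<mu>: "\<mu> \<in> P1" and \<psi>: "continuous_on {0..} \<psi>" "linear_growth \<psi>"
  shows "integrable \<mu> \<psi>"
proof -
  interpret prob_space \<mu> using \<mu> by (simp add: P1_def)
  obtain c where c: "\<And>x. x \<ge> 0 \<Longrightarrow> \<bar>\<psi> x\<bar> \<le> c * (1 + x)"
    using \<psi>(2) by (auto simp: linear_growth_def)
  have m: "\<psi> \<in> borel_measurable \<mu>"
    using borel_measurable_continuous_on_restrict[OF \<psi>(1)]
    by (simp add: measurable_cong_sets[OF sets_P1[OF \<mu>] refl])
  have "integrable \<mu> (\<lambda>x. c * (1 + x))"
    using \<mu> by (intro integrable_mult_right integrable_add) (auto simp: P1_def)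
  then show ?thesis
  proof (rule Bochner_Integration.integrable_bound[OF _ m])
    show "AE x in \<mu>. norm (\<psi> x) \<le> norm (c * (1 + x))"
      using c by (intro AE_I2) (force simp: space_P1[OF \<mu>])
  qed
qed

section \<open>Admissibility of the midpoint measure\<close>

lemma mid_measure_in_P1:
  assumes \<mu>: "\<mu> \<in> P1" and \<nu>: "\<nu> \<in> P1"
  shows "mid_measure \<mu> \<nu> \<in> P1"
proof -
  have s: "sets \<mu> = sets \<nu>" using \<mu> \<nu> by (simp add: sets_P1)
  have "space \<nu> = space \<mu>" using sets_eq_imp_space_eq[OF s] by simp
  then have "emeasure \<mu> (space \<mu>) = 1" "emeasure \<nu> (space \<mu>) = 1"
    using \<mu> \<nu> by (auto simp: P1_def dest: prob_space.emeasure_space_1)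
  then have "prob_space (mid_measure \<mu> \<nu>)"
    by (intro prob_spaceI) (simp add: emeasure_mid_measure[OF s])
  then show ?thesis
    using \<mu> \<nu> integrable_mid_measure[OF s] by (simp add: P1_def)
qed

text \<open>Against each test function the midpoint gives the average of two ordered numbers, which
  lies between them.\<close>

lemma mid_measure_between:
  assumes \<mu>: "\<mu> \<in> P1" and \<nu>: "\<nu> \<in> P1" and le: "\<mu> \<preceq>cx \<nu>"
  shows "\<mu> \<preceq>cx mid_measure \<mu> \<nu>" "mid_measure \<mu> \<nu> \<preceq>cx \<nu>"
proof -
  have s: "sets \<mu> = sets \<nu>" using \<mu> \<nu> by (simp add: sets_P1)
  have "integral\<^sup>L (mid_measure \<mu> \<nu>) \<psi> = (integral\<^sup>L \<mu> \<psi> + integral\<^sup>L \<nu> \<psi>) / 2"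
    "integral\<^sup>L \<mu> \<psi> \<le> integral\<^sup>L \<nu> \<psi>"
    if "continuous_on {0..} \<psi>" "convex_on {0..} \<psi>" "linear_growth \<psi>" for \<psi>
    using that le \<mu> \<nu> by (simp_all add: integral_mid_measure[OF s] integrable_P1 convex_order_def)
  then show "\<mu> \<preceq>cx mid_measure \<mu> \<nu>" "mid_measure \<mu> \<nu> \<preceq>cx \<nu>"
    by (force simp: convex_order_def)+
qed

section \<open>Lipschitz constants and the directed distance\<close>

lemma Lip_le: "L-lipschitz_on {0..} \<psi> \<Longrightarrow> Lip \<psi> \<le> ereal L"
  unfolding Lip_def by (rule INF_lower) simp

text \<open>The Lipschitz inequality survives letting the constant decrease to the infimum. This
  replaces \<open>Lip \<psi>\<close> by a real number that is itself a Lipschitz constant.\<close>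

lemma Lip_attained:
  assumes "\<exists>L. L-lipschitz_on {0..} \<psi>"
  obtains L where "L-lipschitz_on {0..} \<psi>" "Lip \<psi> = ereal L"
proof -
  obtain K where K: "K-lipschitz_on {0..} \<psi>" using assms by auto
  have "Lip \<psi> \<ge> 0"
    unfolding Lip_def by (rule INF_greatest) (auto dest: lipschitz_on_nonneg)
  with Lip_le[OF K] obtain L where L: "Lip \<psi> = ereal L" "0 \<le> L"
    by (cases "Lip \<psi>") auto
  have "L-lipschitz_on {0..} \<psi>"
  proof (rule lipschitz_onI)
    fix x y :: real assume xy: "x \<in> {0..}" "y \<in> {0..}"
    \<comment> \<open>A priori the infimum only yields Lipschitz constants below
      \<open>L + e\<close>, hence the slack \<open>e\<close>.\<close>
    have "dist (\<psi> x) (\<psi> y) \<le> (L + e) * dist x y" if e: "e > 0" for e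
    proof -
      have "Lip \<psi> < ereal (L + e)" using L e by simp
      then obtain K' where K': "K'-lipschitz_on {0..} \<psi>" "K' < L + e"
        unfolding Lip_def by (auto simp: INF_less_iff)
      have "dist (\<psi> x) (\<psi> y) \<le> K' * dist x y" using K'(1) xy by (rule lipschitz_onD)
      also have "\<dots> \<le> (L + e) * dist x y" using K'(2) by (intro mult_right_mono) auto
      finally show ?thesis .
    qed
    \<comment> \<open>Taking \<open>e\<close> as \<open>d / dist x y\<close> turns the slack into
      \<open>d\<close>; for \<open>dist x y = 0\<close> the bound is immediate.\<close>
    then have "dist (\<psi> x) (\<psi> y) \<le> L * dist x y + d" if "d > 0" for d
      using that
      by (cases "dist x y = 0") (force simp: distrib_right dest: spec[of _ "d / dist x y"])+
    then show "dist (\<psi> x) (\<psi> y) \<le> L * dist x y" by (rule field_le_epsilon)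
  qed (use L in auto)
  with L that show ?thesis by blast
qed

text \<open>The zero function competes in the supremum.\<close>

lemma directed_dist_nonneg: "0 \<le> directed_dist \<mu> \<nu>"
proof -
  have "Lip (\<lambda>_. 0) \<le> ereal 0"
    by (rule Lip_le) (auto intro: lipschitz_onI)
  also have "\<dots> \<le> 1" by simp
  finally show ?thesis
    unfolding directed_dist_def by (intro SUP_upper2[of "\<lambda>_. 0"]) (auto simp: convex_on_const)
qed

text \<open>For positive \<open>L\<close> the function \<open>\<psi> / L\<close> is convex with
  Lipschitz constant at most 1, so it competes in the supremum; the estimate is then scaled back by
  \<open>L\<close>.\<close>

lemma integral_diff_le_directed_dist:
  assumes \<mu>: "\<mu> \<in> P1" and \<nu>: "\<nu> \<in> P1"
    and lip: "L-lipschitz_on {0..} \<psi>" and conv: "convex_on {0..} \<psi>"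
  shows "ereal (integral\<^sup>L \<mu> \<psi> - integral\<^sup>L \<nu> \<psi>) \<le> ereal L * directed_dist \<mu> \<nu>"
proof (cases "L = 0")
  \<comment> \<open>No rescaling is possible here, but \<psi> is constant on \<open>{0..}\<close>,
    so both probability measures give it the same integral. The right-hand side is zero even for an
    infinite distance, as \<open>0 * \<infinity> = 0\<close> in \<open>ereal\<close>.\<close>
  case True
  have const: "\<psi> x = \<psi> 0" if "x \<ge> 0" for x
    using lipschitz_onD[OF lip, of x 0] that True by simp
  have "integral\<^sup>L \<rho> \<psi> = \<psi> 0" if "\<rho> \<in> P1" for \<rho>
  proof -
    interpret prob_space \<rho> using that by (simp add: P1_def)
    have "integral\<^sup>L \<rho> \<psi> = integral\<^sup>L \<rho> (\<lambda>_. \<psi> 0)"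
      by (rule Bochner_Integration.integral_cong) (auto simp: space_P1[OF that] intro: const)
    then show ?thesis by (simp add: prob_space)
  qed
  then show ?thesis using \<mu> \<nu> True by (simp flip: zero_ereal_def)
next
  case False
  then have L: "L > 0" using lipschitz_on_nonneg[OF lip] by simp
  let ?\<phi> = "\<lambda>x. (1 / L) * \<psi> x"
  have "1-lipschitz_on {0..} ?\<phi>"
  proof (rule lipschitz_onI)
    fix x y :: real assume "x \<in> {0..}" "y \<in> {0..}"
    then have "dist (\<psi> x) (\<psi> y) \<le> L * dist x y" by (rule lipschitz_onD[OF lip])
    moreover have "dist (?\<phi> x) (?\<phi> y) = dist (\<psi> x) (\<psi> y) / L"
      using L by (simp add: dist_real_def diff_divide_distrib[symmetric])
    ultimately show "dist (?\<phi> x) (?\<phi> y) \<le> 1 * dist x y"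
      using L by (simp only: pos_divide_le_eq mult.commute mult_1)
  qed simp
  then have "Lip ?\<phi> \<le> 1" using Lip_le by (metis one_ereal_def)
  moreover have "convex_on {0..} ?\<phi>" using L conv by (intro convex_on_cmul) auto
  ultimately have "ereal (integral\<^sup>L \<mu> ?\<phi> - integral\<^sup>L \<nu> ?\<phi>) \<le> directed_dist \<mu> \<nu>"
    unfolding directed_dist_def by (intro SUP_upper) simp
  then have "ereal L * ereal ((integral\<^sup>L \<mu> \<psi> - integral\<^sup>L \<nu> \<psi>) / L)
      \<le> ereal L * directed_dist \<mu> \<nu>"
    using L by (intro ereal_mult_left_mono) (simp_all add: diff_divide_distrib)
  then show ?thesis using L by simp
qed

section \<open>The two-sided estimate for the upper price\<close>

theorem proposition4p5:
  fixes \<mu>b \<mu>a :: "real measure" and h \<psi>a \<psi>b :: "real \<Rightarrow> real"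
  assumes "\<mu>b \<in> P1" and "\<mu>a \<in> P1" and "\<mu>b \<preceq>cx \<mu>a"
    and "\<exists>L. L-lipschitz_on {0..} \<psi>a" and "convex_on {0..} \<psi>a"
    and "\<exists>L. L-lipschitz_on {0..} \<psi>b" and "convex_on {0..} \<psi>b"
    and "\<And>x. x \<ge> 0 \<Longrightarrow> h x = \<psi>a x - \<psi>b x"
  shows "0 \<le> upper_price \<mu>b \<mu>a h - ereal (integral\<^sup>L (mid_measure \<mu>b \<mu>a) h)
    \<and> upper_price \<mu>b \<mu>a h - ereal (integral\<^sup>L (mid_measure \<mu>b \<mu>a) h)
           \<le> (Lip \<psi>a + Lip \<psi>b) * bid_ask_dist \<mu>b \<mu>a"
proof -
  let ?m = "mid_measure \<mu>b \<mu>a" and ?D = "directed_dist \<mu>a \<mu>b"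
  obtain La where La: "La-lipschitz_on {0..} \<psi>a" "Lip \<psi>a = ereal La"
    using Lip_attained assms(4) by blast
  obtain Lb where Lb: "Lb-lipschitz_on {0..} \<psi>b" "Lip \<psi>b = ereal Lb"
    using Lip_attained assms(6) by blast
  have L0: "0 \<le> La" "0 \<le> Lb" using La(1) Lb(1) by (auto dest: lipschitz_on_nonneg)
  have cont: "continuous_on {0..} \<psi>a" "continuous_on {0..} \<psi>b"
    using La(1) Lb(1) by (auto intro: lipschitz_on_continuous_on)
  have lin: "linear_growth \<psi>a" "linear_growth \<psi>b"
    using La(1) Lb(1) by (auto intro: lipschitz_imp_linear_growth)
  have int: "integrable \<mu> \<psi>a" "integrable \<mu> \<psi>b" if "\<mu> \<in> P1" for \<mu>
    using that cont lin by (auto intro: integrable_P1)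
  have h: "integral\<^sup>L \<mu> h = integral\<^sup>L \<mu> \<psi>a - integral\<^sup>L \<mu> \<psi>b" if \<mu>: "\<mu> \<in> P1" for \<mu>
  proof -
    have "integral\<^sup>L \<mu> h = (\<integral>x. \<psi>a x - \<psi>b x \<partial>\<mu>)"
      by (rule Bochner_Integration.integral_cong) (auto simp: space_P1[OF \<mu>] assms(8))
    then show ?thesis using int[OF \<mu>] by simp
  qed
  have s: "sets \<mu>b = sets \<mu>a" using assms(1,2) by (simp add: sets_P1)
  have m: "?m \<in> P1" by (rule mid_measure_in_P1[OF assms(1,2)])
  define A where "A = integral\<^sup>L \<mu>a \<psi>a - integral\<^sup>L \<mu>b \<psi>a"
  define B where "B = integral\<^sup>L \<mu>a \<psi>b - integral\<^sup>L \<mu>b \<psi>b"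
  \<comment> \<open>\<open>B\<close> gets a plus sign: the integral of \<open>\<psi>b\<close> under
    \<open>\<mu>b\<close> minus its average over both measures is \<open>- B / 2\<close>, and
    \<open>\<psi>b\<close> is subtracted in \<open>h\<close>.\<close>
  have hm: "integral\<^sup>L \<mu>a \<psi>a - integral\<^sup>L \<mu>b \<psi>b = integral\<^sup>L ?m h + (A + B) / 2"
    using assms(1,2) int
    by (simp add: h[OF m] integral_mid_measure[OF s] A_def B_def field_simps)
  have lower: "ereal (integral\<^sup>L ?m h) \<le> upper_price \<mu>b \<mu>a h"
    unfolding upper_price_def
    using m mid_measure_between[OF assms(1-3)] by (intro SUP_upper) simp
  have upper: "upper_price \<mu>b \<mu>a h \<le> ereal (integral\<^sup>L ?m h + (A + B) / 2)"
    unfolding upper_price_def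
  proof (rule SUP_least)
    fix \<mu> assume \<mu>: "\<mu> \<in> {\<mu> \<in> P1. \<mu>b \<preceq>cx \<mu> \<and> \<mu> \<preceq>cx \<mu>a}"
    \<comment> \<open>As \<open>\<psi>b\<close> is subtracted in \<open>h\<close>, an upper bound
      takes \<open>\<mu> \<preceq>cx \<mu>a\<close> for \<open>\<psi>a\<close> and
      \<open>\<mu>b \<preceq>cx \<mu>\<close> for \<open>\<psi>b\<close>.\<close>
    then have "integral\<^sup>L \<mu> \<psi>a \<le> integral\<^sup>L \<mu>a \<psi>a" "integral\<^sup>L \<mu>b \<psi>b \<le> integral\<^sup>L \<mu> \<psi>b"
      using cont lin assms(5,7) by (auto simp: convex_order_def)
    then show "ereal (integral\<^sup>L \<mu> h) \<le> ereal (integral\<^sup>L ?m h + (A + B) / 2)"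
      using \<mu> by (simp add: h hm[symmetric])
  qed
  \<comment> \<open>Adding the nonnegative reverse distance produces twice
    \<open>bid_ask_dist\<close>.\<close>
  have D: "?D \<le> directed_dist \<mu>b \<mu>a + ?D"
    using add_mono[OF directed_dist_nonneg order_refl] by simp
  have "ereal (A + B) \<le> ereal La * ?D + ereal Lb * ?D"
    unfolding A_def B_def plus_ereal.simps(1)[symmetric]
    using assms(1,2,5,7) La(1) Lb(1)
    by (intro add_mono integral_diff_le_directed_dist)
  \<comment> \<open>Nonnegative constants distribute even if \<open>?D\<close> is infinite.\<close>
  also have "\<dots> = ereal (La + Lb) * ?D"
    using L0 by (simp add: ereal_left_distrib flip: plus_ereal.simps(1))
  also have "\<dots> \<le> ereal (La + Lb) * (directed_dist \<mu>b \<mu>a + ?D)"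
    using L0 D by (intro ereal_mult_left_mono) auto
  finally have "ereal (A + B) / 2 \<le> ereal (La + Lb) * (directed_dist \<mu>b \<mu>a + ?D) / 2"
    by (intro ereal_divide_right_mono) auto
  then have "ereal ((A + B) / 2) \<le> (Lip \<psi>a + Lip \<psi>b) * bid_ask_dist \<mu>b \<mu>a"
    by (simp add: La Lb bid_ask_dist_def ereal_times_divide_eq)
  \<comment> \<open>Subtraction in \<open>ereal\<close> is safe: \<open>lower\<close> excludes the
    value \<open>-\<infinity>\<close> and \<open>upper\<close> the value
    \<open>\<infinity>\<close>.\<close>
  moreover have "upper_price \<mu>b \<mu>a h - ereal (integral\<^sup>L ?m h) \<le> ereal ((A + B) / 2)"
    using upper lower by (cases "upper_price \<mu>b \<mu>a h") (auto simp: field_simps)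
  moreover have "0 \<le> upper_price \<mu>b \<mu>a h - ereal (integral\<^sup>L ?m h)"
    using lower by (cases "upper_price \<mu>b \<mu>a h") auto
  ultimately show ?thesis by (auto intro: order_trans)
qed

end
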